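(* Let $\mathcal{G}$ be a groupoid, $\mathcal{M}$ a wide subgroupoid of $\mathcal{G}$ and $\mathcal{N}$ a normal subgroupoid of $\mathcal{G}$. Then $\mathcal{M}\cap\mathcal{N}\lhd\mathcal{M}$ and $$\frac{\mathcal{M}}{\mathcal{M}\cap\mathcal{N}}\cong\frac{\mathcal{M}\mathcal{N}}{\mathcal{N}}.$$
   Context: A groupoid is a set $\mathcal{G}$ with a partial binary operation, written by concatenation ($\exists gh$ means that $gh$ is defined). An element $e$ is an identity if $\exists eg$ implies $eg=g$ and $\exists g'e$ implies $g'e=g'$; $\mathcal{G}_0$ is the set of identities. Axioms: (i) $\exists g(hl)$ iff $\exists (gh)l$, and then $g(hl)=(gh)l$; (ii) $\exists g(hl)$ iff $\exists gh$ and $\exists hl$; (iii) for each $g$ there are unique identities $d(g),r(g)$ with $\exists gd(g)$ and $\exists r(g)g$; (iv) for each $g$ there is $g^{-1}$ with $\exists g^{-1}g$, $\exists gg^{-1}$, $d(g)=g^{-1}g$, $r(g)=gg^{-1}$. (Thus $\exists gh$ iff $d(g)=r(h)$.) For $e\in\mathcal{G}_0$, $\mathcal{G}_e=\{g\in\mathcal{G}\mid d(g)=r(g)=e\}$. A subgroupoid is a nonempty subset closed under inverses and under defined products; it is wide if it has the same set of identities as $\mathcal{G}$. For subgroupoids $\mathcal{H},\mathcal{K}$, $\mathcal{H}\mathcal{K}=\{hk\mid h\in\mathcal{H},k\in\mathcal{K},\exists hk\}$. A subgroupoid $\mathcal{H}$ of $\mathcal{G}$ is normal, $\mathcal{H}\lhd\mathcal{G}$,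 if for all $g\in\mathcal{G}$ the set $g^{-1}\mathcal{H}g=\{g^{-1}hg\mid h\in\mathcal{H}\cap\mathcal{G}_{r(g)}\}$ is nonempty and contained in $\mathcal{H}$ (nonemptiness for all $g$ is equivalent to $\mathcal{H}$ being wide). For $\mathcal{H}\lhd\mathcal{G}$, write $g\equiv_{\mathcal{H}}l$ iff $\exists l^{-1}g$ and $l^{-1}g\in\mathcal{H}$; the class of $g$ is the left coset $g\mathcal{H}=\{gh\mid h\in\mathcal{H},\ r(h)=d(g)\}$. The quotient groupoid $\mathcal{G}/\mathcal{H}$ is the set of all left cosets of $\mathcal{H}$ in $\mathcal{G}$, with $\exists(g\mathcal{H})(l\mathcal{H})$ iff $\exists gl$, and partial binary operation $(g\mathcal{H})(l\mathcal{H})=gl\mathcal{H}$. A homomorphism of groupoids is a map $\phi$ such that $\exists xy$ implies $\exists\phi(x)\phi(y)$ and $\phi(xy)=\phi(x)\phi(y)$; an isomorphism is a bijective homomorphism, and $\cong$ means that there is an isomorphism. *)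

theory Defs
  imports Main
begin

text \<open>A set with a partial binary operation; \<open>pmult G g h = None\<close> means that \<open>gh\<close> is not defined.\<close>

record 'a pmagma =
  carrier :: "'a set"
  pmult :: "'a \<Rightarrow> 'a \<Rightarrow> 'a option"

definition defined :: "'a pmagma \<Rightarrow> 'a \<Rightarrow> 'a \<Rightarrow> bool" where
  "defined G g h \<longleftrightarrow> pmult G g h \<noteq> None"

definition identity :: "'a pmagma \<Rightarrow> 'a \<Rightarrow> bool" where
  "identity G e \<longleftrightarrow> e \<in> carrier G \<and>
     (\<forall>g. defined G e g \<longrightarrow> pmult G e g = Some g) \<and>
     (\<forall>g. defined G g e \<longrightarrow> pmult G g e = Some g)"

definition identities :: "'a pmagma \<Rightarrow> 'a set" where
  "identities G = {e. identity G e}"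

definition dm :: "'a pmagma \<Rightarrow> 'a \<Rightarrow> 'a" where
  "dm G g = (THE e. identity G e \<and> defined G g e)"

definition rg :: "'a pmagma \<Rightarrow> 'a \<Rightarrow> 'a" where
  "rg G g = (THE e. identity G e \<and> defined G e g)"

text \<open>\<open>Option.bind\<close> expresses iterated products: \<open>g(hl)\<close> is \<open>Option.bind (hl) (\<lambda>x. gx)\<close>, which is
  \<open>None\<close> unless both \<open>hl\<close> and \<open>g(hl)\<close> are defined.\<close>

locale groupoid =
  fixes G :: "'a pmagma"
  assumes pmult_in_carrier:
      "pmult G g h = Some k \<Longrightarrow> g \<in> carrier G \<and> h \<in> carrier G \<and> k \<in> carrier G"
    and assoc:
      "Option.bind (pmult G h l) (\<lambda>x. pmult G g x) = Option.bind (pmult G g h) (\<lambda>x. pmult G x l)"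
    and defined_assoc_iff:
      "Option.bind (pmult G h l) (\<lambda>x. pmult G g x) \<noteq> None \<longleftrightarrow> defined G g h \<and> defined G h l"
    and ex1_dm: "g \<in> carrier G \<Longrightarrow> \<exists>!e. identity G e \<and> defined G g e"
    and ex1_rg: "g \<in> carrier G \<Longrightarrow> \<exists>!e. identity G e \<and> defined G e g"
    and ex_inverse:
      "g \<in> carrier G \<Longrightarrow> \<exists>g'. pmult G g' g = Some (dm G g) \<and> pmult G g g' = Some (rg G g)"

definition ginv :: "'a pmagma \<Rightarrow> 'a \<Rightarrow> 'a" where
  "ginv G g = (THE g'. pmult G g' g = Some (dm G g) \<and> pmult G g g' = Some (rg G g))"

definition isotropy :: "'a pmagma \<Rightarrow> 'a \<Rightarrow> 'a set" where
  "isotropy G e = {g \<in> carrier G. dm G g = e \<and> rg G g = e}"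

text \<open>The partial operation induced on a subset \<open>S\<close>: \<open>gh\<close> is defined in \<open>S\<close> iff \<open>g\<close>, \<open>h\<close> lie in \<open>S\<close> and
  \<open>gh\<close> is defined in \<open>G\<close> and lies in \<open>S\<close>. The last condition is automatic for subgroupoids; it is
  stated because a product \<open>HK\<close> of subgroupoids need not be closed under products.\<close>

definition induced :: "'a pmagma \<Rightarrow> 'a set \<Rightarrow> 'a pmagma" where
  "induced G S = \<lparr>carrier = S,
     pmult = (\<lambda>g h. if g \<in> S \<and> h \<in> S \<and> (\<exists>k\<in>S. pmult G g h = Some k) then pmult G g h else None)\<rparr>"

definition subgroupoid :: "'a pmagma \<Rightarrow> 'a set \<Rightarrow> bool" where
  "subgroupoid G H \<longleftrightarrow> H \<subseteq> carrier G \<and> H \<noteq> {} \<and>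
     (\<forall>h\<in>H. ginv G h \<in> H) \<and>
     (\<forall>g\<in>H. \<forall>h\<in>H. \<forall>k. pmult G g h = Some k \<longrightarrow> k \<in> H)"

definition wide_subgroupoid :: "'a pmagma \<Rightarrow> 'a set \<Rightarrow> bool" where
  "wide_subgroupoid G H \<longleftrightarrow> subgroupoid G H \<and> identities (induced G H) = identities G"

definition set_mult :: "'a pmagma \<Rightarrow> 'a set \<Rightarrow> 'a set \<Rightarrow> 'a set" where
  "set_mult G H K = {x. \<exists>h\<in>H. \<exists>k\<in>K. pmult G h k = Some x}"

definition conj_set :: "'a pmagma \<Rightarrow> 'a \<Rightarrow> 'a set \<Rightarrow> 'a set" where
  "conj_set G g H =
     {x. \<exists>h \<in> H \<inter> isotropy G (rg G g). Option.bind (pmult G (ginv G g) h) (\<lambda>y. pmult G y g) = Some x}"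

definition normal_subgroupoid :: "'a pmagma \<Rightarrow> 'a set \<Rightarrow> bool" where
  "normal_subgroupoid G H \<longleftrightarrow> subgroupoid G H \<and>
     (\<forall>g\<in>carrier G. conj_set G g H \<noteq> {} \<and> conj_set G g H \<subseteq> H)"

definition lcoset :: "'a pmagma \<Rightarrow> 'a \<Rightarrow> 'a set \<Rightarrow> 'a set" where
  "lcoset G g H = {x. \<exists>h\<in>H. rg G h = dm G g \<and> pmult G g h = Some x}"

text \<open>The product of two cosets is defined iff some representatives \<open>g\<close>, \<open>l\<close> are composable. Equal left
  cosets \<open>gH = g'H\<close> force \<open>r(g) = r(g')\<close> but not \<open>d(g) = d(g')\<close>, so composability does depend on the
  representatives; for normal \<open>H\<close> the resulting coset \<open>glH\<close> does not, which makes \<open>THE\<close> well defined.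
  As in \<open>induced\<close>, \<open>gl\<close> is computed in the structure \<open>G\<close> that is divided by \<open>H\<close>.\<close>

definition quotient_groupoid :: "'a pmagma \<Rightarrow> 'a set \<Rightarrow> 'a set pmagma" where
  "quotient_groupoid G H = \<lparr>carrier = {lcoset G g H | g. g \<in> carrier G},
     pmult = (\<lambda>A B.
       let P = (\<lambda>Q. \<exists>g l k. g \<in> carrier G \<and> l \<in> carrier G \<and> A = lcoset G g H \<and> B = lcoset G l H \<and>
                      pmult G g l = Some k \<and> Q = lcoset G k H)
       in if \<exists>Q. P Q then Some (THE Q. P Q) else None)\<rparr>"

definition homomorphism :: "('a \<Rightarrow> 'b) \<Rightarrow> 'a pmagma \<Rightarrow> 'b pmagma \<Rightarrow> bool" where
  "homomorphism \<phi> G H \<longleftrightarrow> (\<forall>x\<in>carrier G. \<phi> x \<in> carrier H) \<and>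
     (\<forall>x\<in>carrier G. \<forall>y\<in>carrier G. \<forall>z.
        pmult G x y = Some z \<longrightarrow> pmult H (\<phi> x) (\<phi> y) = Some (\<phi> z))"

definition isomorphic :: "'a pmagma \<Rightarrow> 'b pmagma \<Rightarrow> bool" where
  "isomorphic G H \<longleftrightarrow> (\<exists>\<phi>. homomorphism \<phi> G H \<and> bij_betw \<phi> (carrier G) (carrier H))"

end

theory Submission
  imports Defs
begin

text \<open>
  Write \<open>H\<close> for \<open>M \<inter> N\<close>. The isomorphism sends \<open>mH\<close> to \<open>mN\<close>, as in the second isomorphism theorem
  for groups. Without choosing representatives it is \<open>A \<mapsto> AN\<close>, with inverse \<open>B \<mapsto> B \<inter> M\<close>; the latter
  works because \<open>mn \<in> M\<close> forces \<open>n = m\<^sup>-\<^sup>1(mn) \<in> M\<close>, so that \<open>mN \<inter> M = mH\<close>. It is onto because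
  \<open>(mn)N = mN\<close>, so every coset met by \<open>MN\<close> already has a representative in \<open>M\<close>.

  The point that differs from groups is that a normal subgroupoid is tested only on its isotropy
  elements and may connect different identities. Hence \<open>MN\<close> need not be closed under products, and
  quotients of \<open>MN\<close> cannot be treated as quotients of a groupoid. Instead, both quotients in the
  theorem are compared with the cosets of \<open>N\<close> in all of \<open>G\<close>. Call a set \<open>S\<close> \<open>N\<close>-saturated if it
  contains the identities and, for \<open>g \<in> S\<close> and \<open>n \<in> N\<close> with \<open>gn\<close> defined, \<open>gn\<close> lies in \<open>S\<close> exactly
  when \<open>n\<close> does. Both \<open>M\<close> and \<open>MN\<close> are \<open>N\<close>-saturated, for opposite reasons: \<open>M\<close> because
  \<open>n = g\<^sup>-\<^sup>1(gn)\<close>, \<open>MN\<close> because it contains \<open>N\<close> and absorbs it on the right. For saturated \<open>S\<close> the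
  coset of \<open>g\<close> by \<open>S \<inter> N\<close> computed in \<open>S\<close> is \<open>gN \<inter> S\<close> (\<open>lcoset_saturated\<close>), and it determines \<open>gN\<close>.

  The product of cosets is well defined in \<open>G\<close> because composable representatives leave no freedom
  in the middle: if \<open>gl\<close> and \<open>(gn)(ln')\<close> are both defined then \<open>r(ln') = r(l)\<close> forces \<open>n\<close> to be an
  isotropy element, so normality gives \<open>gnln' = gl(l\<^sup>-\<^sup>1nl)n' \<in> glN\<close> (\<open>lcoset_mult_cong\<close>). By the
  comparison this passes to every saturated set (\<open>pmult_quotient_saturated\<close>), and the homomorphism
  property follows at once.
\<close>

section \<open>Calculation in a groupoid\<close>

lemma identityD:
  "identity G e \<Longrightarrow> pmult G e g = Some k \<Longrightarrow> k = g"
  "identity G e \<Longrightarrow> pmult G g e = Some k \<Longrightarrow> k = g"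
  unfolding identity_def defined_def by (metis option.distinct(1) option.inject)+

lemma subgroupoidD:
  assumes "subgroupoid G H"
  shows subgroupoid_subset: "H \<subseteq> carrier G"
    and subgroupoid_nonempty: "H \<noteq> {}"
    and subgroupoid_ginv: "h \<in> H \<Longrightarrow> ginv G h \<in> H"
    and subgroupoid_pmult: "g \<in> H \<Longrightarrow> h \<in> H \<Longrightarrow> pmult G g h = Some k \<Longrightarrow> k \<in> H"
  using assms unfolding subgroupoid_def by blast+

lemma conj_set_iff:
  "x \<in> conj_set G g H \<longleftrightarrow> (\<exists>h\<in>H. \<exists>a. h \<in> isotropy G (rg G g) \<and>
     pmult G (ginv G g) h = Some a \<and> pmult G a g = Some x)"
  by (auto simp: conj_set_def bind_eq_Some_conv)

lemma Some_The_eq_iff: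
  assumes unique: "\<And>x y. R x \<Longrightarrow> R y \<Longrightarrow> x = y"
  shows "(if \<exists>x. R x then Some (THE x. R x) else None) = Some y \<longleftrightarrow> R y"
proof -
  have "(THE x. R x) = x" if "R x" for x
    using that unique by (intro the_equality)
  then show ?thesis
    by auto
qed

context groupoid
begin

lemma identity_in_carrier: "identity G e \<Longrightarrow> e \<in> carrier G"
  by (simp add: identity_def)

lemma dm_identity: "g \<in> carrier G \<Longrightarrow> identity G (dm G g)"
  and defined_dm: "g \<in> carrier G \<Longrightarrow> defined G g (dm G g)"
  using theI'[OF ex1_dm, of g] unfolding dm_def by auto

lemma rg_identity: "g \<in> carrier G \<Longrightarrow> identity G (rg G g)"
  and defined_rg: "g \<in> carrier G \<Longrightarrow> defined G (rg G g) g"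
  using theI'[OF ex1_rg, of g] unfolding rg_def by auto

lemma dm_unique: "g \<in> carrier G \<Longrightarrow> identity G e \<Longrightarrow> defined G g e \<Longrightarrow> dm G g = e"
  using ex1_dm[of g] dm_identity[of g] defined_dm[of g] by blast

lemma rg_unique: "g \<in> carrier G \<Longrightarrow> identity G e \<Longrightarrow> defined G e g \<Longrightarrow> rg G g = e"
  using ex1_rg[of g] rg_identity[of g] defined_rg[of g] by blast

lemma pmult_dm: "g \<in> carrier G \<Longrightarrow> pmult G g (dm G g) = Some g"
  using dm_identity[of g] defined_dm[of g] by (simp add: identity_def)

lemma pmult_rg: "g \<in> carrier G \<Longrightarrow> pmult G (rg G g) g = Some g"
  using rg_identity[of g] defined_rg[of g] by (simp add: identity_def)

lemma dm_of_identity: assumes "identity G e" shows "dm G e = e"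
  using identityD(1)[OF assms pmult_dm] identity_in_carrier[OF assms] by simp

lemma rg_of_identity: assumes "identity G e" shows "rg G e = e"
  using identityD(2)[OF assms pmult_rg] identity_in_carrier[OF assms] by simp

lemma pmult_assoc:
  assumes "pmult G g h = Some k" "pmult G h l = Some m"
  obtains x where "pmult G k l = Some x" "pmult G g m = Some x"
  using assoc[of h l g] defined_assoc_iff[of h l g] assms by (auto simp: defined_def)

text \<open>The identity \<open>d(g)\<close> can be inserted into any product \<open>gh = (g d(g))h\<close>; then \<open>d(g)h\<close> is defined, so
  \<open>d(g)\<close> is the one identity that \<open>h\<close> accepts on its left.\<close>

lemma defined_iff:
  assumes g: "g \<in> carrier G" and h: "h \<in> carrier G"
  shows "defined G g h \<longleftrightarrow> dm G g = rg G h"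
proof
  assume "defined G g h"
  then have "Option.bind (pmult G (dm G g) h) (\<lambda>x. pmult G g x) \<noteq> None"
    using assoc[of "dm G g" h g] pmult_dm[OF g] by (simp add: defined_def)
  then have "defined G (dm G g) h"
    by (auto simp: defined_def bind_eq_Some_conv)
  then show "dm G g = rg G h"
    using rg_unique[OF h dm_identity[OF g]] by simp
next
  assume "dm G g = rg G h"
  then show "defined G g h"
    using pmult_dm[OF g] pmult_rg[OF h] defined_assoc_iff[of "dm G g" h g]
    by (auto simp: defined_def)
qed

lemma pmult_dm_rg: "pmult G g h = Some k \<Longrightarrow> dm G g = rg G h"
  using defined_iff[of g h] pmult_in_carrier[of g h k] by (simp add: defined_def)

lemma ex_pmult:
  assumes "g \<in> carrier G" "h \<in> carrier G" "dm G g = rg G h"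
  obtains k where "pmult G g h = Some k"
  using defined_iff[of g h] assms by (auto simp: defined_def)

lemma dm_pmult:
  assumes "pmult G g h = Some k" shows "dm G k = dm G h"
proof -
  have h: "h \<in> carrier G" and k: "k \<in> carrier G"
    using pmult_in_carrier[OF assms] by auto
  obtain x where "pmult G k (dm G h) = Some x"
    using pmult_assoc[OF assms pmult_dm[OF h]] by metis
  then show ?thesis
    using dm_unique[OF k dm_identity[OF h]] by (simp add: defined_def)
qed

lemma rg_pmult:
  assumes "pmult G g h = Some k" shows "rg G k = rg G g"
proof -
  have g: "g \<in> carrier G" and k: "k \<in> carrier G"
    using pmult_in_carrier[OF assms] by auto
  obtain x where "pmult G (rg G g) k = Some x"
    using pmult_assoc[OF pmult_rg[OF g] assms] by metis
  then show ?thesis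
    using rg_unique[OF k rg_identity[OF g]] by (simp add: defined_def)
qed

lemma inverse_unique:
  assumes "pmult G a g = Some (dm G g)" "pmult G g b = Some (rg G g)"
  shows "a = b"
proof -
  obtain x where x: "pmult G (dm G g) b = Some x" "pmult G a (rg G g) = Some x"
    using pmult_assoc[OF assms] by metis
  have g: "g \<in> carrier G"
    using pmult_in_carrier[OF assms(1)] by auto
  show ?thesis
    using identityD(1)[OF dm_identity[OF g] x(1)] identityD(2)[OF rg_identity[OF g] x(2)] by simp
qed

lemma ginv:
  assumes "g \<in> carrier G"
  shows "pmult G (ginv G g) g = Some (dm G g)" "pmult G g (ginv G g) = Some (rg G g)"
proof -
  have "\<exists>!g'. pmult G g' g = Some (dm G g) \<and> pmult G g g' = Some (rg G g)"
    using ex_inverse[OF assms] inverse_unique by blast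
  from theI'[OF this]
  show "pmult G (ginv G g) g = Some (dm G g)" "pmult G g (ginv G g) = Some (rg G g)"
    unfolding ginv_def by auto
qed

lemma ginv_pmult_cancel:
  assumes "pmult G g h = Some k" shows "pmult G (ginv G g) k = Some h"
proof -
  have g: "g \<in> carrier G"
    using pmult_in_carrier[OF assms] by auto
  obtain x where x: "pmult G (dm G g) h = Some x" "pmult G (ginv G g) k = Some x"
    using pmult_assoc[OF ginv(1)[OF g] assms] by metis
  show ?thesis
    using identityD(1)[OF dm_identity[OF g] x(1)] x(2) by simp
qed

lemma pmult_ginv_cancel:
  assumes "pmult G g h = Some k" shows "pmult G k (ginv G h) = Some g"
proof -
  have h: "h \<in> carrier G"
    using pmult_in_carrier[OF assms] by auto
  obtain x where x: "pmult G k (ginv G h) = Some x" "pmult G g (rg G h) = Some x"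
    using pmult_assoc[OF assms ginv(2)[OF h]] by metis
  show ?thesis
    using identityD(2)[OF rg_identity[OF h] x(2)] x(1) by simp
qed

text \<open>Since \<open>h = g\<^sup>-\<^sup>1(gh)\<close>.\<close>

lemma subgroupoid_left_cancel:
  assumes "subgroupoid G M" "g \<in> M" "pmult G g h = Some k"
  shows "k \<in> M \<longleftrightarrow> h \<in> M"
  using assms ginv_pmult_cancel[OF assms(3)] unfolding subgroupoid_def by blast


section \<open>Operations induced on subsets containing all identities\<close>

lemma pmult_induced_iff:
  "pmult (induced G S) g h = Some k \<longleftrightarrow> g \<in> S \<and> h \<in> S \<and> k \<in> S \<and> pmult G g h = Some k"
  by (auto simp: induced_def)

lemma defined_induced_iff:
  "defined (induced G S) g h \<longleftrightarrow> g \<in> S \<and> h \<in> S \<and> (\<exists>k\<in>S. pmult G g h = Some k)"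
  by (auto simp: defined_def induced_def)

lemma identity_induced:
  assumes "identities G \<subseteq> S" "S \<subseteq> carrier G"
  shows "identity (induced G S) e \<longleftrightarrow> identity G e"
proof
  assume e: "identity G e"
  then show "identity (induced G S) e"
    using assms identityD[OF e] unfolding identity_def[of "induced G S"] identities_def
    by (auto simp: induced_def defined_def)
next
  assume e: "identity (induced G S) e"
  then have eS: "e \<in> S"
    by (simp add: identity_def induced_def)
  then have ec: "e \<in> carrier G"
    using assms by auto
  have d: "dm G e \<in> S"
    using assms dm_identity[OF ec] by (auto simp: identities_def)
  \<comment> \<open>The product of \<open>e\<close> with its domain is available inside \<open>S\<close>, and evaluates to both factors.\<close>
  have p: "pmult (induced G S) e (dm G e) = Some e"
    using d eS pmult_dm[OF ec] by (simp add: induced_def)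
  show "identity G e"
    using identityD(1)[OF e p] dm_identity[OF ec] by simp
qed

lemma dm_induced:
  assumes "identities G \<subseteq> S" "S \<subseteq> carrier G" "g \<in> S"
  shows "dm (induced G S) g = dm G g"
proof -
  have g: "g \<in> carrier G"
    using assms by auto
  show ?thesis
    unfolding dm_def[of "induced G S"]
  proof (rule the_equality)
    show "identity (induced G S) (dm G g) \<and> defined (induced G S) g (dm G g)"
      using assms dm_identity[OF g] pmult_dm[OF g]
      by (auto simp: identity_induced defined_induced_iff identities_def)
  next
    fix e
    assume "identity (induced G S) e \<and> defined (induced G S) g e"
    then show "e = dm G g"
      using dm_unique[OF g, of e] assms
      by (auto simp: identity_induced defined_induced_iff defined_def[of G])
  qed
qed

lemma rg_induced:
  assumes "identities G \<subseteq> S" "S \<subseteq> carrier G" "g \<in> S"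
  shows "rg (induced G S) g = rg G g"
proof -
  have g: "g \<in> carrier G"
    using assms by auto
  show ?thesis
    unfolding rg_def[of "induced G S"]
  proof (rule the_equality)
    show "identity (induced G S) (rg G g) \<and> defined (induced G S) (rg G g) g"
      using assms rg_identity[OF g] pmult_rg[OF g]
      by (auto simp: identity_induced defined_induced_iff identities_def)
  next
    fix e
    assume "identity (induced G S) e \<and> defined (induced G S) e g"
    then show "e = rg G g"
      using rg_unique[OF g, of e] assms
      by (auto simp: identity_induced defined_induced_iff defined_def[of G])
  qed
qed

lemma wide_subgroupoid_identities:
  "wide_subgroupoid G M \<Longrightarrow> identities G \<subseteq> M"
  unfolding wide_subgroupoid_def identities_def by (auto simp: identity_def induced_def)

lemma pmult_induced_subgroupoid:
  assumes "subgroupoid G M" "g \<in> M" "h \<in> M"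
  shows "pmult (induced G M) g h = pmult G g h"
proof (cases "pmult G g h")
  case None
  then show ?thesis
    by (simp add: induced_def)
next
  case (Some k)
  then have "k \<in> M"
    using assms unfolding subgroupoid_def by blast
  then show ?thesis
    using Some assms pmult_induced_iff by simp
qed

lemma ginv_induced:
  assumes M: "wide_subgroupoid G M" and g: "g \<in> M"
  shows "ginv (induced G M) g = ginv G g"
proof -
  have sub: "subgroupoid G M"
    using M by (simp add: wide_subgroupoid_def)
  have gc: "g \<in> carrier G" and g': "ginv G g \<in> M" and Mc: "M \<subseteq> carrier G"
    using subgroupoid_subset[OF sub] subgroupoid_ginv[OF sub] g by blast+
  note ids = wide_subgroupoid_identities[OF M]
  show ?thesis
    unfolding ginv_def[of "induced G M"] dm_induced[OF ids Mc g] rg_induced[OF ids Mc g]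
  proof (rule the_equality)
    show "pmult (induced G M) (ginv G g) g = Some (dm G g) \<and>
        pmult (induced G M) g (ginv G g) = Some (rg G g)"
      using ginv[OF gc] pmult_induced_subgroupoid[OF sub] g g' by simp
  next
    fix a
    assume "pmult (induced G M) a g = Some (dm G g) \<and> pmult (induced G M) g a = Some (rg G g)"
    then have "pmult G a g = Some (dm G g)"
      by (simp add: pmult_induced_iff)
    then show "a = ginv G g"
      using inverse_unique[OF _ ginv(2)[OF gc]] by simp
  qed
qed


section \<open>Left cosets\<close>

lemma lcoset_iff:
  assumes "g \<in> carrier G"
  shows "x \<in> lcoset G g H \<longleftrightarrow> (\<exists>h\<in>H. pmult G g h = Some x)"
  using pmult_dm_rg unfolding lcoset_def by fastforce

lemma lcoset_absorb:
  assumes H: "subgroupoid G H" and h: "h \<in> H" and k: "pmult G g h = Some k"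
  shows "lcoset G k H = lcoset G g H"
proof -
  have absorb: "lcoset G k H \<subseteq> lcoset G g H" if h: "h \<in> H" and k: "pmult G g h = Some k" for g h k
  proof
    fix x
    have c: "g \<in> carrier G" "k \<in> carrier G"
      using pmult_in_carrier[OF k] by auto
    assume "x \<in> lcoset G k H"
    then obtain h' where h': "h' \<in> H" "pmult G k h' = Some x"
      using lcoset_iff[OF c(2)] by auto
    have hc: "h \<in> carrier G" "h' \<in> carrier G"
      using pmult_in_carrier[OF k] pmult_in_carrier[OF h'(2)] by auto
    have "dm G h = rg G h'"
      using dm_pmult[OF k] pmult_dm_rg[OF h'(2)] by simp
    then obtain m where m: "pmult G h h' = Some m"
      using ex_pmult hc by metis
    have "pmult G g m = Some x"
      using pmult_assoc[OF k m] h'(2) by (metis option.inject)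
    moreover have "m \<in> H"
      using H h h'(1) m unfolding subgroupoid_def by blast
    ultimately show "x \<in> lcoset G g H"
      using lcoset_iff[OF c(1)] by auto
  qed
  have "ginv G h \<in> H"
    using subgroupoid_ginv[OF H h] .
  then show ?thesis
    using absorb[OF h k] absorb[OF _ pmult_ginv_cancel[OF k]] by blast
qed

lemma lcoset_self:
  assumes "identities G \<subseteq> H" "g \<in> carrier G"
  shows "g \<in> lcoset G g H"
  using assms dm_identity[of g] pmult_dm[of g] by (auto simp: lcoset_iff identities_def)

lemma lcoset_eqI:
  assumes "subgroupoid G H" "g \<in> carrier G" "x \<in> lcoset G g H"
  shows "lcoset G x H = lcoset G g H"
  using assms lcoset_absorb by (auto simp: lcoset_iff)

text \<open>The conjugate \<open>g\<^sup>-\<^sup>1hg\<close> presupposes an isotropy element \<open>h\<close> of \<open>N\<close> at \<open>r(g)\<close>; then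
  \<open>h\<^sup>-\<^sup>1h\<close> is the identity there. Letting \<open>g\<close> run over the identities reaches all of them.\<close>

lemma normal_subgroupoid_identities:
  assumes N: "normal_subgroupoid G N"
  shows "identities G \<subseteq> N"
proof
  fix e
  assume "e \<in> identities G"
  then have e: "identity G e"
    by (simp add: identities_def)
  then have "conj_set G e N \<noteq> {}"
    using N identity_in_carrier by (auto simp: normal_subgroupoid_def)
  then obtain h where h: "h \<in> N" "h \<in> isotropy G e"
    using rg_of_identity[OF e] by (auto simp: conj_set_iff)
  then have "pmult G (ginv G h) h = Some e"
    using ginv(1)[of h] by (auto simp: isotropy_def)
  then show "e \<in> N"
    using N h(1) unfolding normal_subgroupoid_def subgroupoid_def by blast
qed

text \<open>Moving an element of \<open>N\<close> past \<open>l\<close>: this is the form in which normality is used,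
  \<open>nl = l(l\<^sup>-\<^sup>1nl)\<close>.\<close>

lemma normal_subgroupoid_swap:
  assumes N: "normal_subgroupoid G N" and n: "n \<in> N" "dm G n = rg G n"
    and m: "pmult G n l = Some m"
  obtains n' where "n' \<in> N" "pmult G l n' = Some m"
proof -
  have c: "n \<in> carrier G" "l \<in> carrier G" "m \<in> carrier G"
    using pmult_in_carrier[OF m] by auto
  have rn: "rg G n = rg G l"
    using pmult_dm_rg[OF m] n by simp
  then have iso: "n \<in> isotropy G (rg G l)"
    using c n by (simp add: isotropy_def)
  have gc: "ginv G l \<in> carrier G"
    using pmult_in_carrier[OF ginv(1)[OF c(2)]] by simp
  have dg: "dm G (ginv G l) = rg G l"
    using dm_pmult[OF ginv(2)[OF c(2)]] dm_of_identity[OF rg_identity[OF c(2)]] by simp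
  obtain a where a: "pmult G (ginv G l) n = Some a"
    using ex_pmult[OF gc c(1)] dg rn by auto
  obtain x where x: "pmult G a l = Some x" "pmult G (ginv G l) m = Some x"
    using pmult_assoc[OF a m] by metis
  have "x \<in> conj_set G l N"
    using n iso a x unfolding conj_set_iff by blast
  then have "x \<in> N"
    using N c by (auto simp: normal_subgroupoid_def)
  moreover have "pmult G l x = Some m"
  proof -
    obtain y where y: "pmult G (rg G l) m = Some y" "pmult G l x = Some y"
      using pmult_assoc[OF ginv(2)[OF c(2)] x(2)] by metis
    show ?thesis
      using identityD(1)[OF rg_identity[OF c(2)] y(1)] y(2) by simp
  qed
  ultimately show ?thesis
    using that by blast
qed

text \<open>If \<open>gn\<close> and \<open>g\<close> can both be composed with elements of one coset \<open>lN\<close>, then \<open>d(gn) = r(l) = d(g)\<close>.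
  So \<open>n\<close> is an isotropy element, even though \<open>N\<close> may contain others, and it can be moved past \<open>l\<close>.\<close>

lemma lcoset_mult_cong:
  assumes N: "normal_subgroupoid G N"
    and k: "pmult G g l = Some k" and k': "pmult G g' l' = Some k'"
    and g: "lcoset G g' N = lcoset G g N" and l: "lcoset G l' N = lcoset G l N"
  shows "lcoset G k' N = lcoset G k N"
proof -
  note ids = normal_subgroupoid_identities[OF N]
  have sub: "subgroupoid G N"
    using N by (simp add: normal_subgroupoid_def)
  have c: "g \<in> carrier G" "l \<in> carrier G" "g' \<in> carrier G" "l' \<in> carrier G"
    using pmult_in_carrier[OF k] pmult_in_carrier[OF k'] by auto
  obtain n where n: "n \<in> N" "pmult G g n = Some g'"
    using lcoset_self[OF ids c(3)] g lcoset_iff[OF c(1)] by auto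
  obtain n' where n': "n' \<in> N" "pmult G l n' = Some l'"
    using lcoset_self[OF ids c(4)] l lcoset_iff[OF c(2)] by auto
  have rl: "rg G l' = rg G l"
    using rg_pmult[OF n'(2)] .
  have dn: "dm G n = rg G l"
    using dm_pmult[OF n(2)] pmult_dm_rg[OF k'] rl by simp
  have rn: "rg G n = rg G l"
    using pmult_dm_rg[OF n(2)] pmult_dm_rg[OF k] by simp
  have nc: "n \<in> carrier G"
    using pmult_in_carrier[OF n(2)] by simp
  obtain m where m: "pmult G n l = Some m"
    using ex_pmult[OF nc c(2) dn] by metis
  obtain n'' where n'': "n'' \<in> N" "pmult G l n'' = Some m"
    using normal_subgroupoid_swap[OF N n(1) _ m] dn rn by auto
  \<comment> \<open>\<open>p = g'l = gnl = g l n'' = k n''\<close>, and then \<open>k' = g'l' = p n'\<close>\<close>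
  obtain p where p: "pmult G g' l = Some p" "pmult G g m = Some p"
    using pmult_assoc[OF n(2) m] by metis
  have p1: "pmult G k n'' = Some p"
    using pmult_assoc[OF k n''(2)] p(2) by (metis option.inject)
  have p2: "pmult G p n' = Some k'"
    using pmult_assoc[OF p(1) n'(2)] k' by (metis option.inject)
  show ?thesis
    using lcoset_absorb[OF sub n''(1) p1] lcoset_absorb[OF sub n'(1) p2] by simp
qed


section \<open>Quotients of saturated subsets\<close>

text \<open>The condition on products is the common feature of subgroupoids containing the identities and of
  products \<open>MN\<close>; it makes the cosets of \<open>S \<inter> N\<close> in \<open>S\<close> the traces on \<open>S\<close> of the cosets of \<open>N\<close> in \<open>G\<close>.\<close>

definition saturated :: "'a set \<Rightarrow> 'a set \<Rightarrow> bool" where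
  "saturated N S \<longleftrightarrow> S \<subseteq> carrier G \<and> identities G \<subseteq> S \<and>
     (\<forall>g\<in>S. \<forall>n\<in>N. \<forall>k. pmult G g n = Some k \<longrightarrow> (k \<in> S \<longleftrightarrow> n \<in> S))"

lemma saturated_wide_subgroupoid:
  assumes "wide_subgroupoid G M" shows "saturated N M"
proof -
  have "subgroupoid G M"
    using assms by (simp add: wide_subgroupoid_def)
  then show ?thesis
    using wide_subgroupoid_identities[OF assms] subgroupoid_left_cancel subgroupoid_subset
    unfolding saturated_def by blast
qed

lemma subset_set_mult:
  assumes "M \<subseteq> carrier G" "identities G \<subseteq> N"
  shows "M \<subseteq> set_mult G M N"
  using assms dm_identity pmult_dm unfolding set_mult_def identities_def by blast

lemma subset_set_mult_right:
  assumes "N \<subseteq> carrier G" "identities G \<subseteq> M"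
  shows "N \<subseteq> set_mult G M N"
  using assms rg_identity pmult_rg unfolding set_mult_def identities_def by blast

lemma set_mult_absorb:
  assumes N: "subgroupoid G N" and x: "x \<in> set_mult G M N" and n: "n \<in> N" and k: "pmult G x n = Some k"
  shows "k \<in> set_mult G M N"
proof -
  obtain m n' where m: "m \<in> M" "n' \<in> N" "pmult G m n' = Some x"
    using x by (auto simp: set_mult_def)
  have mc: "m \<in> carrier G" and xc: "x \<in> carrier G"
    using pmult_in_carrier[OF m(3)] by auto
  have "k \<in> lcoset G m N"
    using lcoset_absorb[OF N m(2,3)] n k lcoset_iff[OF xc] by auto
  then show ?thesis
    using m(1) lcoset_iff[OF mc] by (auto simp: set_mult_def)
qed

lemma saturated_set_mult:
  assumes N: "subgroupoid G N" "identities G \<subseteq> N" and M: "M \<subseteq> carrier G" "identities G \<subseteq> M"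
  shows "saturated N (set_mult G M N)"
proof -
  have Nc: "N \<subseteq> carrier G"
    using subgroupoid_subset[OF N(1)] .
  have "set_mult G M N \<subseteq> carrier G"
    using pmult_in_carrier by (auto simp: set_mult_def)
  then show ?thesis
    using subset_set_mult[OF M(1) N(2)] subset_set_mult_right[OF Nc M(2)] M(2)
      set_mult_absorb[OF N(1)] unfolding saturated_def by blast
qed

lemma lcoset_saturated:
  assumes S: "saturated N S" and g: "g \<in> S"
  shows "lcoset (induced G S) g (S \<inter> N) = lcoset G g N \<inter> S"
proof -
  have s: "identities G \<subseteq> S" "S \<subseteq> carrier G"
    using S unfolding saturated_def by blast+
  have gc: "g \<in> carrier G"
    using g s by auto
  have "x \<in> lcoset (induced G S) g (S \<inter> N) \<longleftrightarrow> x \<in> lcoset G g N \<inter> S" for x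
  proof
    assume "x \<in> lcoset (induced G S) g (S \<inter> N)"
    then show "x \<in> lcoset G g N \<inter> S"
      using lcoset_iff[OF gc] by (auto simp: lcoset_def[of "induced G S"] pmult_induced_iff)
  next
    assume x: "x \<in> lcoset G g N \<inter> S"
    then obtain n where n: "n \<in> N" "pmult G g n = Some x"
      using lcoset_iff[OF gc] by auto
    then have nS: "n \<in> S"
      using S g x unfolding saturated_def by blast
    have "rg (induced G S) n = dm (induced G S) g"
      using pmult_dm_rg[OF n(2)] rg_induced[OF s nS] dm_induced[OF s g] by simp
    moreover have "pmult (induced G S) g n = Some x"
      using n nS g x by (simp add: pmult_induced_iff)
    ultimately show "x \<in> lcoset (induced G S) g (S \<inter> N)"
      using n nS by (auto simp: lcoset_def)
  qed
  then show ?thesis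
    by blast
qed

text \<open>Since \<open>g \<in> gN \<inter> S\<close>, the trace of a coset determines the coset.\<close>

lemma lcoset_trace_eq_iff:
  assumes "subgroupoid G N" "identities G \<subseteq> N" "S \<subseteq> carrier G" "g \<in> S" "g' \<in> S"
  shows "lcoset G g N \<inter> S = lcoset G g' N \<inter> S \<longleftrightarrow> lcoset G g N = lcoset G g' N"
proof
  assume eq: "lcoset G g N \<inter> S = lcoset G g' N \<inter> S"
  have gc: "g \<in> carrier G" "g' \<in> carrier G"
    using assms by auto
  have "g \<in> lcoset G g' N"
    using lcoset_self[OF assms(2) gc(1)] assms(4) eq by blast
  then show "lcoset G g N = lcoset G g' N"
    using lcoset_eqI[OF assms(1) gc(2)] by simp
qed simp

lemma carrier_quotient_saturated:
  assumes "saturated N S"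
  shows "carrier (quotient_groupoid (induced G S) (S \<inter> N)) = {lcoset G g N \<inter> S | g. g \<in> S}"
  using lcoset_saturated[OF assms] by (auto simp: quotient_groupoid_def induced_def)

text \<open>Equal traces come from equal cosets of \<open>N\<close> in \<open>G\<close>, whose product does not depend on the composable
  representatives; products that leave \<open>S\<close> never enter the argument.\<close>

lemma pmult_quotient_saturated:
  assumes N: "normal_subgroupoid G N" and S: "saturated N S"
  shows "pmult (quotient_groupoid (induced G S) (S \<inter> N)) A B = Some Q \<longleftrightarrow>
    (\<exists>g\<in>S. \<exists>l\<in>S. \<exists>k\<in>S. A = lcoset G g N \<inter> S \<and> B = lcoset G l N \<inter> S \<and>
       pmult G g l = Some k \<and> Q = lcoset G k N \<inter> S)"
    (is "_ \<longleftrightarrow> ?R Q")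
proof -
  let ?P = "\<lambda>Q. \<exists>g l k. g \<in> carrier (induced G S) \<and> l \<in> carrier (induced G S) \<and>
      A = lcoset (induced G S) g (S \<inter> N) \<and> B = lcoset (induced G S) l (S \<inter> N) \<and>
      pmult (induced G S) g l = Some k \<and> Q = lcoset (induced G S) k (S \<inter> N)"
  have sub: "subgroupoid G N"
    using N by (simp add: normal_subgroupoid_def)
  note ids = normal_subgroupoid_identities[OF N]
  have Sc: "S \<subseteq> carrier G"
    using S unfolding saturated_def by blast
  have cS: "carrier (induced G S) = S"
    by (simp add: induced_def)
  have PR: "?P Q \<longleftrightarrow> ?R Q" for Q
    unfolding pmult_induced_iff cS using lcoset_saturated[OF S] by blast
  have unique: "Q = Q'" if Q: "?R Q" and Q': "?R Q'" for Q Q'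
  proof -
    obtain g l k where 1: "g \<in> S" "l \<in> S" "k \<in> S" "A = lcoset G g N \<inter> S" "B = lcoset G l N \<inter> S"
      "pmult G g l = Some k" "Q = lcoset G k N \<inter> S"
      using Q by blast
    obtain g' l' k' where 2: "g' \<in> S" "l' \<in> S" "k' \<in> S" "A = lcoset G g' N \<inter> S"
      "B = lcoset G l' N \<inter> S" "pmult G g' l' = Some k'" "Q' = lcoset G k' N \<inter> S"
      using Q' by blast
    have "lcoset G g N = lcoset G g' N" "lcoset G l N = lcoset G l' N"
      using lcoset_trace_eq_iff[OF sub ids Sc 1(1) 2(1)] 1(4) 2(4)
        lcoset_trace_eq_iff[OF sub ids Sc 1(2) 2(2)] 1(5) 2(5) by simp_all
    then show ?thesis
      using lcoset_mult_cong[OF N 2(6) 1(6)] 1(7) 2(7) by simp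
  qed
  have "pmult (quotient_groupoid (induced G S) (S \<inter> N)) A B = (if \<exists>Q. ?P Q then Some (THE Q. ?P Q) else None)"
    unfolding quotient_groupoid_def Let_def pmagma.select_convs ..
  also have "\<dots> = (if \<exists>Q. ?R Q then Some (THE Q. ?R Q) else None)"
    unfolding PR ..
  finally have eq: "pmult (quotient_groupoid (induced G S) (S \<inter> N)) A B =
    (if \<exists>Q. ?R Q then Some (THE Q. ?R Q) else None)" .
  show ?thesis
    unfolding eq by (rule Some_The_eq_iff[OF unique])
qed


section \<open>The intersection and the isomorphism\<close>

lemma normal_subgroupoid_inter:
  assumes M: "wide_subgroupoid G M" and N: "normal_subgroupoid G N"
  shows "normal_subgroupoid (induced G M) (M \<inter> N)"
proof -
  have subM: "subgroupoid G M"
    using M by (simp add: wide_subgroupoid_def)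
  have subN: "subgroupoid G N"
    using N by (simp add: normal_subgroupoid_def)
  note idM = wide_subgroupoid_identities[OF M] and idN = normal_subgroupoid_identities[OF N]
  have Mc: "M \<subseteq> carrier G"
    using subgroupoid_subset[OF subM] .
  note dmM = dm_induced[OF idM Mc] and rgM = rg_induced[OF idM Mc]
    and ginvM = ginv_induced[OF M] and pM = pmult_induced_subgroupoid[OF subM]
  have cM: "carrier (induced G M) = M"
    by (simp add: induced_def)
  have closedM: "\<And>g h k. \<lbrakk>g \<in> M; h \<in> M; pmult G g h = Some k\<rbrakk> \<Longrightarrow> k \<in> M" and invM: "\<And>g. g \<in> M \<Longrightarrow> ginv G g \<in> M"
    using subgroupoid_pmult[OF subM] subgroupoid_ginv[OF subM] by blast+
  obtain m where m: "m \<in> M"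
    using subgroupoid_nonempty[OF subM] by blast
  then have "dm G m \<in> M \<inter> N"
    using dm_identity[of m] Mc idM idN by (auto simp: identities_def)
  moreover have "\<forall>h\<in>M \<inter> N. ginv (induced G M) h \<in> M \<inter> N"
    using ginvM invM subgroupoid_ginv[OF subN] by simp
  moreover have "k \<in> M \<inter> N" if "g \<in> M \<inter> N" "h \<in> M \<inter> N" "pmult (induced G M) g h = Some k" for g h k
    using that pM[of g h] closedM[of g h k] subgroupoid_pmult[OF subN, of g h k] by simp
  ultimately have sub: "subgroupoid (induced G M) (M \<inter> N)"
    unfolding subgroupoid_def[of "induced G M"] cM by blast
  have "conj_set (induced G M) g (M \<inter> N) \<noteq> {} \<and> conj_set (induced G M) g (M \<inter> N) \<subseteq> M \<inter> N"
    if g: "g \<in> M" for g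
  proof
    have gc: "g \<in> carrier G"
      using g Mc by auto
    have iso: "isotropy (induced G M) e = M \<inter> isotropy G e" for e
      using dmM rgM Mc by (auto simp: isotropy_def cM)
    let ?e = "rg G g"
    have e: "identity G ?e"
      by (rule rg_identity[OF gc])
    have eMN: "?e \<in> M \<inter> N"
      using e idM idN by (auto simp: identities_def)
    have eiso: "?e \<in> isotropy G ?e"
      using e dm_of_identity rg_of_identity identity_in_carrier by (simp add: isotropy_def)
    obtain x where x: "pmult G (ginv G g) ?e = Some x"
      using pmult_assoc[OF ginv(1)[OF gc] ginv(2)[OF gc]] by metis
    have "x = ginv G g"
      using identityD(2)[OF e x] .
    then have xg: "pmult G x g = Some (dm G g)"
      using ginv(1)[OF gc] by simp
    \<comment> \<open>Conjugating the identity \<open>r(g)\<close> by \<open>g\<close> gives \<open>d(g)\<close>.\<close>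
    have "dm G g \<in> conj_set (induced G M) g (M \<inter> N)"
      unfolding conj_set_iff rgM[OF g] iso ginvM[OF g]
      using eMN eiso x xg pM g invM \<open>x = ginv G g\<close> by auto
    then show "conj_set (induced G M) g (M \<inter> N) \<noteq> {}"
      by blast
    show "conj_set (induced G M) g (M \<inter> N) \<subseteq> M \<inter> N"
    proof
      fix y
      assume "y \<in> conj_set (induced G M) g (M \<inter> N)"
      then obtain h a where h: "h \<in> M" "h \<in> N" "h \<in> isotropy G (rg G g)"
        and a: "pmult G (ginv G g) h = Some a" and y: "pmult (induced G M) a g = Some y"
        unfolding conj_set_iff rgM[OF g] iso ginvM[OF g]
        using pM invM[OF g] by auto
      have aM: "a \<in> M"
        using closedM[OF invM[OF g] h(1) a] .
      have y': "pmult G a g = Some y"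
        using y pM[OF aM g] by simp
      have "y \<in> conj_set G g N"
        using h a y' unfolding conj_set_iff by blast
      then show "y \<in> M \<inter> N"
        using closedM[OF aM g y'] N gc by (auto simp: normal_subgroupoid_def)
    qed
  qed
  then show ?thesis
    using sub unfolding normal_subgroupoid_def cM by blast
qed

lemma set_mult_lcoset_trace:
  assumes N: "subgroupoid G N" "identities G \<subseteq> N" and M: "M \<subseteq> carrier G" and m: "m \<in> M"
  shows "set_mult G (lcoset G m N \<inter> M) N = lcoset G m N"
proof
  have mc: "m \<in> carrier G"
    using m M by auto
  show "set_mult G (lcoset G m N \<inter> M) N \<subseteq> lcoset G m N"
  proof
    fix x
    assume "x \<in> set_mult G (lcoset G m N \<inter> M) N"
    then obtain a n where a: "a \<in> lcoset G m N" "n \<in> N" "pmult G a n = Some x"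
      by (auto simp: set_mult_def)
    have "a \<in> carrier G"
      using pmult_in_carrier[OF a(3)] by simp
    then show "x \<in> lcoset G m N"
      using lcoset_eqI[OF N(1) mc a(1)] lcoset_iff a(2,3) by blast
  qed
  show "lcoset G m N \<subseteq> set_mult G (lcoset G m N \<inter> M) N"
    using lcoset_self[OF N(2) mc] m lcoset_iff[OF mc] unfolding set_mult_def by blast
qed

lemma isomorphic_quotients:
  assumes M: "wide_subgroupoid G M" and N: "normal_subgroupoid G N"
  shows "isomorphic (quotient_groupoid (induced G M) (M \<inter> N))
    (quotient_groupoid (induced G (set_mult G M N)) N)"
proof -
  let ?S = "set_mult G M N"
  let ?Q1 = "quotient_groupoid (induced G M) (M \<inter> N)"
  let ?Q2 = "quotient_groupoid (induced G ?S) N"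
  let ?\<phi> = "\<lambda>A. set_mult G A N"
  have subN: "subgroupoid G N"
    using N by (simp add: normal_subgroupoid_def)
  note idM = wide_subgroupoid_identities[OF M] and idN = normal_subgroupoid_identities[OF N]
  have Mc: "M \<subseteq> carrier G"
    using M subgroupoid_subset unfolding wide_subgroupoid_def by blast
  have Nc: "N \<subseteq> carrier G"
    using subgroupoid_subset[OF subN] .
  note satM = saturated_wide_subgroupoid[OF M, of N]
    and satS = saturated_set_mult[OF subN idN Mc idM]
  have MS: "M \<subseteq> ?S"
    by (rule subset_set_mult[OF Mc idN])
  have SN: "?S \<inter> N = N"
    using subset_set_mult_right[OF Nc idM] by blast
  have Sc: "?S \<subseteq> carrier G"
    using satS unfolding saturated_def by blast
  have trace: "lcoset G g N \<inter> ?S = lcoset G g N" if "g \<in> ?S" for g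
  proof -
    have "g \<in> carrier G"
      using that Sc by blast
    then show ?thesis
      using lcoset_iff set_mult_absorb[OF subN that] by blast
  qed
  have \<phi>: "?\<phi> (lcoset G m N \<inter> M) = lcoset G m N" if "m \<in> M" for m
    using set_mult_lcoset_trace[OF subN idN Mc that] .
  have c1: "carrier ?Q1 = {lcoset G m N \<inter> M | m. m \<in> M}"
    by (rule carrier_quotient_saturated[OF satM])
  have rep: "\<exists>m\<in>M. lcoset G g N = lcoset G m N" if "g \<in> ?S" for g
    using that lcoset_absorb[OF subN] by (auto simp: set_mult_def)
  have "carrier ?Q2 = {lcoset G g N \<inter> ?S | g. g \<in> ?S}"
    by (rule carrier_quotient_saturated[OF satS, unfolded SN])
  also have "\<dots> = {lcoset G g N | g. g \<in> ?S}"
    using trace by (intro Collect_cong) metis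
  also have "\<dots> = {lcoset G m N | m. m \<in> M}"
    using rep MS by (intro Collect_cong) (metis subsetD)
  finally have c2: "carrier ?Q2 = {lcoset G m N | m. m \<in> M}" .
  have "bij_betw ?\<phi> (carrier ?Q1) (carrier ?Q2)"
    by (rule bij_betw_byWitness[where f' = "\<lambda>B. B \<inter> M"]) (auto simp: c1 c2 \<phi>)
  moreover have "homomorphism ?\<phi> ?Q1 ?Q2"
    unfolding homomorphism_def
  proof (intro conjI ballI allI impI)
    fix A
    assume "A \<in> carrier ?Q1"
    then show "?\<phi> A \<in> carrier ?Q2"
      using \<phi> unfolding c1 c2 by auto
  next
    fix A B Q
    assume "pmult ?Q1 A B = Some Q"
    then obtain g l k where 1: "g \<in> M" "l \<in> M" "k \<in> M" "A = lcoset G g N \<inter> M"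
      "B = lcoset G l N \<inter> M" "pmult G g l = Some k" "Q = lcoset G k N \<inter> M"
      unfolding pmult_quotient_saturated[OF N satM] by blast
    have S: "g \<in> ?S" "l \<in> ?S" "k \<in> ?S"
      using 1(1-3) MS by blast+
    have "?\<phi> A = lcoset G g N \<inter> ?S" "?\<phi> B = lcoset G l N \<inter> ?S" "?\<phi> Q = lcoset G k N \<inter> ?S"
      unfolding 1(4,5,7) \<phi>[OF 1(1)] \<phi>[OF 1(2)] \<phi>[OF 1(3)] using trace S by simp_all
    then show "pmult ?Q2 (?\<phi> A) (?\<phi> B) = Some (?\<phi> Q)"
      using pmult_quotient_saturated[OF N satS, unfolded SN] S 1(6) by blast
  qed
  ultimately show ?thesis
    unfolding isomorphic_def by blast
qed

end

theorem theorem3p18: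
  fixes G :: "'a pmagma" and M N :: "'a set"
  assumes "groupoid G"
    and "wide_subgroupoid G M"
    and "normal_subgroupoid G N"
  shows "normal_subgroupoid (induced G M) (M \<inter> N) \<and>
    isomorphic (quotient_groupoid (induced G M) (M \<inter> N)) (quotient_groupoid (induced G (set_mult G M N)) N)"
  using groupoid.normal_subgroupoid_inter[OF assms] groupoid.isomorphic_quotients[OF assms] ..

end
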